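(* Let $n\ge2$ and suppose that $E\neq\emptyset$ is a compact and porous set in $\mathbb{R}^n$. Let $\beta<0$ and $1\le p<q<np/(n-p)<\infty$ be such that there is a constant $C>0$ for which the inequality $$\biggl(\int_{\mathbb{R}^n} |f(x)|^q \, \delta_E(x)^{(q/p)(n-p+\beta)-n}\,dx\biggr)^{1/q}\le C\biggl(\int_{\mathbb{R}^n} |\nabla f(x)|^p\,\delta_E(x)^\beta\,dx\biggr)^{1/p}$$ holds for every $f\in C^\infty_0(\mathbb{R}^n)$. Then $$\overline{\dim}_A(E)<\frac{q}{p}(n-p+\beta).$$
   Context: $\delta_E(x)=\operatorname{dist}(x,E)$, $B(x,R)$ is the open ball, $d(E)$ is the diameter of $E$, and $C_0^\infty(\mathbb{R}^n)$ denotes smooth functions with compact support in $\mathbb{R}^n$. A set $E\subset\mathbb{R}^n$ is porous if there is a constant $0<c<1$ such that for every $x\in E$ and all $0<r<d(E)$ there is a point $y\in\mathbb{R}^n$ with $B(y,cr)\subset B(x,r)\setminus E$. For bounded $A\subset\mathbb{R}^n$ and $r>0$, $N(A,r)$ is the minimal number of open balls of radius $r$ centered at points of $A$ needed to cover $A$. The (upper) Assouad dimension is $\overline{\dim}_A(E)=\inf\{\lambda\ge 0:\ \exists\, C_\lambda>0 \text{ such that } N(E\cap B(x,R),r)\le C_\lambda (r/R)^{-\lambda}\text{ for all } x\in E,\ 0<r<R<d(E)\}$. *)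

theory Defs
  imports "HOL-Analysis.Analysis"
begin

text \<open>Powers in \<open>[0, \<infinity>]\<close> with \<open>0\<^sup>a = \<infinity>\<close> for \<open>a < 0\<close>; the real operator \<^term>\<open>(powr)\<close> would give
  \<open>0 powr a = 0\<close>, making a weight with negative exponent vanish on the set itself.\<close>

definition epowr :: "ennreal \<Rightarrow> real \<Rightarrow> ennreal" where
  "epowr t a =
     (if a = 0 then 1
      else if t = 0 then (if a < 0 then \<infinity> else 0)
      else if t = \<infinity> then (if a < 0 then 0 else \<infinity>)
      else ennreal (enn2real t powr a))"

text \<open>Inductively: \<open>f\<close> is of class \<open>C\<^bsup>k+1\<^esup>\<close> iff it is differentiable everywhere and all its
  directional derivatives are of class \<open>C\<^bsup>k\<^esup>\<close>.\<close>

primrec Ck :: "nat \<Rightarrow> ('a::euclidean_space \<Rightarrow> real) \<Rightarrow> bool" where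
  "Ck 0 f \<longleftrightarrow> continuous_on UNIV f"
| "Ck (Suc k) f \<longleftrightarrow> (\<forall>x. f differentiable (at x)) \<and> (\<forall>v. Ck k (\<lambda>x. frechet_derivative f (at x) v))"

definition C0_infty :: "('a::euclidean_space \<Rightarrow> real) set" where
  "C0_infty = {f. (\<forall>k. Ck k f) \<and> compact (closure {x. f x \<noteq> 0})}"

definition gradient :: "('a::euclidean_space \<Rightarrow> real) \<Rightarrow> 'a \<Rightarrow> 'a" where
  "gradient f x = (\<Sum>b\<in>Basis. frechet_derivative f (at x) b *\<^sub>R b)"

lemma GDERIV_gradient:
  assumes "f differentiable (at x)"
  shows "GDERIV f x :> gradient f x"
proof -
  have D: "(f has_derivative frechet_derivative f (at x)) (at x)"
    using assms by (simp add: frechet_derivative_works)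
  then have lin: "linear (frechet_derivative f (at x))"
    by (rule has_derivative_linear)
  have "frechet_derivative f (at x) h = h \<bullet> gradient f x" for h
    using Linear_Algebra.linear_componentwise[OF lin, of h 1]
    by (simp add: gradient_def inner_sum_right mult.commute)
  then have "frechet_derivative f (at x) = (\<lambda>h. h \<bullet> gradient f x)" ..
  with D show ?thesis by (simp add: gderiv_def)
qed

text \<open>The library's \<^const>\<open>diameter\<close> is a real number with no meaning on unbounded sets. Hence
  \<open>r < d(E)\<close>, where \<open>d(E) = \<infinity>\<close> if \<open>E\<close> is unbounded, is written \<open>bounded E \<longrightarrow> r < diameter E\<close>.\<close>

definition porous :: "'a::euclidean_space set \<Rightarrow> bool" where
  "porous E \<longleftrightarrow>
     (\<exists>c. 0 < c \<and> c < 1 \<and>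
        (\<forall>x\<in>E. \<forall>r. 0 < r \<and> (bounded E \<longrightarrow> r < diameter E) \<longrightarrow>
           (\<exists>y. ball y (c * r) \<subseteq> ball x r - E)))"

definition covering_number :: "'a::euclidean_space set \<Rightarrow> real \<Rightarrow> nat" where
  "covering_number A r =
     (LEAST k. \<exists>F. finite F \<and> F \<subseteq> A \<and> card F = k \<and> A \<subseteq> (\<Union>x\<in>F. ball x r))"

text \<open>The infimum is taken over a nonempty set, since \<open>\<lambda> = DIM('a)\<close> is always admissible.\<close>

definition Assouad_dim :: "'a::euclidean_space set \<Rightarrow> real" where
  "Assouad_dim E =
     Inf {l. 0 \<le> l \<and>
       (\<exists>C>0. \<forall>x\<in>E. \<forall>r R. 0 < r \<and> r < R \<and> (bounded E \<longrightarrow> R < diameter E) \<longrightarrow>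
          real (covering_number (E \<inter> ball x R) r) \<le> C * (r / R) powr (- l))}"

end

theory Submission
  imports Defs
begin

text \<open>Put \<open>s = (q/p)(n - p + \<beta>)\<close>, \<open>a = n - s\<close> and \<open>b = -
\<beta>\<close>, write \<open>\<delta>\<close> for the distance to \<open>E\<close>, and let
\<open>\<mu>\<close> be the measure with density \<open>\<delta>^(-a)\<close>, the weight on the
left side. The condition \<open>q < n p / (n - p)\<close> says that \<open>b q < a p\<close>;
together with \<open>p < q\<close> this gives \<open>0 < b < a\<close>.

\<^bold>\<open>Growth of \<mu>.\<close> Testing the inequality with a smooth function that is
\<open>1\<close> on \<open>B(x,R)\<close>, is supported in \<open>B(x,2R)\<close> and has a gradient
of size at most \<open>L/R\<close> bounds \<open>\<mu>(B(x,R))\<close> in terms of the integral of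
\<open>\<delta>^(-b)\<close> over the annulus (lemma \<open>Hardy_Sobolev_on_balls\<close>). An
annulus far from \<open>E\<close> shows that \<open>\<mu>\<close> is finite on bounded sets. For
small balls, the integral of \<open>\<delta>^(-b)\<close> over \<open>B(x,2R)\<close> is controlled
by interpolation between the volume and \<open>\<mu>(B(x,2R))\<close>. If \<open>\<mu>(B(x,2R))
\<le> M (2R)^s\<close> with \<open>M \<ge> 1\<close>, the outcome is \<open>\<mu>(B(x,R)) \<le> c
M^g R^s\<close> with \<open>g = b q / (a p) < 1\<close>. So a large enough constant \<open>M\<close>
survives the passage from \<open>2R\<close> to \<open>R\<close>, and \<open>\<mu>(B(x,R)) \<le> M
R^s\<close> holds for all \<open>x\<close> in \<open>E\<close> and all small \<open>R\<close> (lemma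
\<open>dist_measure_growth\<close>).

\<^bold>\<open>From growth to dimension.\<close> By porosity, a set of \<open>m\<close> points of
\<open>E \<inter> B(x,R)\<close> with mutual distances at least \<open>\<kappa>^j R\<close>
contributes at least a constant multiple of \<open>m \<kappa>^(j s) R^s\<close> to
\<open>\<mu>(B(x,2R))\<close>, and the contributions of different \<open>j\<close> come from
disjoint sets. Hence the sum of these terms over \<open>j\<close> is bounded by a constant
independent of \<open>x\<close>, \<open>R\<close> and the number of scales (lemma
\<open>dist_measure_packing\<close>). Boundedness of each single term would give the dimension bound
\<open>s\<close>; boundedness of the sum makes some term among the first \<open>J\<close> small,
which leaves room for an exponent \<open>l < s\<close> (lemma \<open>packing_exponent_gap\<close>).
This is where the strict inequality comes from.\<close>

section \<open>Smooth cutoff functions\<close>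

text \<open>The factors \<open>t^(-k)\<close> are included so that the family is closed under differentiation up
to linear combinations; \<open>flat_exp 0\<close> is the standard smooth function that vanishes
exactly for \<open>t \<le> 0\<close>.\<close>

definition flat_exp :: "nat \<Rightarrow> real \<Rightarrow> real" where
  "flat_exp k t = (if 0 < t then (1 / t) ^ k * exp (- (1 / t)) else 0)"

lemma power_times_exp_minus_le_fact:
  fixes u :: real
  assumes "0 \<le> u"
  shows "u ^ k * exp (- u) \<le> fact k"
proof -
  have "(\<Sum>i\<in>{k}. u ^ i /\<^sub>R fact i) \<le> (\<Sum>i. u ^ i /\<^sub>R fact i)"
    using summable_exp_generic[of u] assms by (intro sum_le_suminf) auto
  then have "u ^ k / fact k \<le> exp u"
    by (simp add: exp_def divide_inverse mult.commute)
  then show ?thesis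
    by (simp add: exp_minus field_simps)
qed

text \<open>This quadratic bound gives the derivative \<open>0\<close> at the origin.\<close>

lemma flat_exp_le_square: "\<bar>flat_exp k t\<bar> \<le> fact (k + 2) * t\<^sup>2"
proof (cases "0 < t")
  case True
  have "flat_exp k t = ((1 / t) ^ (k + 2) * exp (- (1 / t))) * t\<^sup>2"
    using True by (simp add: flat_exp_def power_add field_simps power2_eq_square)
  also have "\<dots> \<le> fact (k + 2) * t\<^sup>2"
    using True by (intro mult_right_mono power_times_exp_minus_le_fact) auto
  finally show ?thesis using True by (simp add: flat_exp_def)
qed (simp add: flat_exp_def)

lemma flat_exp_has_derivative:
  "(flat_exp k has_real_derivative flat_exp (k + 2) t - k * flat_exp (k + 1) t) (at t)"
proof -
  consider "t > 0" | "t < 0" | "t = 0" by linarith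
  then show ?thesis
  proof cases
    case 1
    have "((\<lambda>t. 1 / t) has_real_derivative - (1 / t)\<^sup>2) (at t)"
      using 1 by (auto intro!: derivative_eq_intros simp: power2_eq_square)
    note d = DERIV_power[OF this, of k] DERIV_fun_exp[OF DERIV_minus[OF this]]
    have "((\<lambda>t. (1 / t) ^ k * exp (- (1 / t))) has_real_derivative
        flat_exp (k + 2) t - k * flat_exp (k + 1) t) (at t)"
      using DERIV_mult[OF d] 1
      by (cases k) (simp_all add: flat_exp_def power2_eq_square algebra_simps)
    then show ?thesis
      by (rule has_field_derivative_transform_within_open[where S="{0<..}"])
         (use 1 in \<open>auto simp: flat_exp_def\<close>)
  next
    case 2
    have "((\<lambda>t. 0) has_real_derivative 0) (at t)" by simp
    then have "(flat_exp k has_real_derivative 0) (at t)"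
      by (rule has_field_derivative_transform_within_open[where S="{..<0}"])
         (use 2 in \<open>auto simp: flat_exp_def\<close>)
    then show ?thesis using 2 by (simp add: flat_exp_def)
  next
    case 3
    have "((\<lambda>h. flat_exp k h / h) \<longlongrightarrow> 0) (at 0)"
    proof (rule Lim_null_comparison)
      show "\<forall>\<^sub>F h in at 0. norm (flat_exp k h / h) \<le> fact (k + 2) * \<bar>h\<bar>"
        using flat_exp_le_square[of k]
        by (auto simp: eventually_at_filter power2_eq_square divide_le_eq abs_mult mult.assoc
              intro!: always_eventually)
      show "((\<lambda>h. fact (k + 2) * \<bar>h\<bar>) \<longlongrightarrow> 0) (at (0::real))"
        by (rule tendsto_eq_intros refl | simp)+
    qed
    then show ?thesis
      using 3 by (simp add: DERIV_def flat_exp_def)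
  qed
qed

text \<open>To prove that a concrete function is of class \<open>C^k\<close> for all \<open>k\<close>, it
suffices to put it into a set of differentiable functions that is closed under directional
derivatives. This is such a set; the linear functions are there because they are the derivatives of
squared distances.\<close>

inductive_set smooth_term :: "('a::euclidean_space \<Rightarrow> real) set" where
  const: "(\<lambda>_. c) \<in> smooth_term"
| linear: "(\<lambda>x. x \<bullet> v) \<in> smooth_term"
| sqdist: "(\<lambda>x. (x - a) \<bullet> (x - a)) \<in> smooth_term"
| add: "f \<in> smooth_term \<Longrightarrow> g \<in> smooth_term \<Longrightarrow> (\<lambda>x. f x + g x) \<in> smooth_term"
| mult: "f \<in> smooth_term \<Longrightarrow> g \<in> smooth_term \<Longrightarrow> (\<lambda>x. f x * g x) \<in> smooth_term"
| flat: "f \<in> smooth_term \<Longrightarrow> (\<lambda>x. flat_exp k (f x)) \<in> smooth_term"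

text \<open>The derivatives of the generators are again in the set, and the sum, product and chain rules
propagate this, because the derivative of \<open>flat_exp k\<close> is a combination of
\<open>flat_exp (k + 2)\<close> and \<open>flat_exp (k + 1)\<close>.\<close>

lemma smooth_term_derivative:
  assumes "f \<in> smooth_term"
  shows "\<exists>f'. (\<forall>x. (f has_derivative (\<lambda>v. f' v x)) (at x)) \<and> (\<forall>v. f' v \<in> smooth_term)"
  using assms
proof induction
  case (const c)
  show ?case
    by (rule exI[of _ "\<lambda>v x. 0"]) (auto intro: smooth_term.const)
next
  case (linear v)
  show ?case
    by (rule exI[of _ "\<lambda>w x. w \<bullet> v"])
       (auto intro!: smooth_term.const derivative_eq_intros)
next
  case (sqdist a)
  have "(\<lambda>x. 2 * (x \<bullet> w + - (a \<bullet> w))) \<in> smooth_term" for w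
    by (intro smooth_term.intros)
  then show ?case
    by (intro exI[of _ "\<lambda>w x. 2 * (x \<bullet> w + - (a \<bullet> w))"])
       (auto intro!: derivative_eq_intros simp: algebra_simps inner_commute)
next
  case (add f g)
  then obtain f' g' where
    "\<And>x. (f has_derivative (\<lambda>v. f' v x)) (at x)" "\<And>v. f' v \<in> smooth_term"
    "\<And>x. (g has_derivative (\<lambda>v. g' v x)) (at x)" "\<And>v. g' v \<in> smooth_term"
    by metis
  then show ?case
    by (intro exI[of _ "\<lambda>v x. f' v x + g' v x"])
       (auto intro!: derivative_eq_intros smooth_term.add)
next
  case (mult f g)
  then obtain f' g' where
    "\<And>x. (f has_derivative (\<lambda>v. f' v x)) (at x)" "\<And>v. f' v \<in> smooth_term"
    "\<And>x. (g has_derivative (\<lambda>v. g' v x)) (at x)" "\<And>v. g' v \<in> smooth_term"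
    by metis
  with mult.hyps show ?case
    by (intro exI[of _ "\<lambda>v x. f x * g' v x + f' v x * g x"] conjI allI)
       (auto intro!: has_derivative_mult smooth_term.add smooth_term.mult)
next
  case (flat f k)
  then obtain f' where
    f': "\<And>x. (f has_derivative (\<lambda>v. f' v x)) (at x)" "\<And>v. f' v \<in> smooth_term"
    by metis
  let ?h = "\<lambda>x. flat_exp (k + 2) (f x) + (- real k) * flat_exp (k + 1) (f x)"
  have "((\<lambda>x. flat_exp k (f x)) has_derivative (\<lambda>v. ?h x * f' v x)) (at x)" for x
    using has_derivative_compose[OF f'(1)
        flat_exp_has_derivative[of k "f x", unfolded has_field_derivative_def]]
    by simp
  moreover have "(\<lambda>x. ?h x * f' v x) \<in> smooth_term" for v
    using flat.hyps f'(2) by (intro smooth_term.intros) 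
  ultimately show ?case
    by (intro exI[of _ "\<lambda>v x. ?h x * f' v x"]) auto
qed

lemma smooth_term_Ck:
  assumes "f \<in> smooth_term"
  shows "Ck k f"
  using assms
proof (induction k arbitrary: f)
  case 0
  then obtain f' where "\<And>x. (f has_derivative (\<lambda>v. f' v x)) (at x)"
    using smooth_term_derivative by metis
  then show ?case
    by (auto intro!: continuous_at_imp_continuous_on dest: has_derivative_continuous)
next
  case (Suc k)
  then obtain f' where f': "\<And>x. (f has_derivative (\<lambda>v. f' v x)) (at x)" "\<And>v. f' v \<in> smooth_term"
    using smooth_term_derivative by metis
  have "frechet_derivative f (at x) v = f' v x" for v x
    using fun_cong[OF frechet_derivative_at[OF f'(1)[of x]], of v] by simp
  with f' Suc.IH show ?case
    by (auto simp: differentiable_def)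
qed

lemma gradient_eqI:
  assumes "(f has_derivative f') (at x)"
  shows "gradient f x = (\<Sum>b\<in>Basis. f' b *\<^sub>R b)"
  using frechet_derivative_at[OF assms] by (simp add: gradient_def)

lemma gradient_locally_const:
  fixes f :: "'a::euclidean_space \<Rightarrow> real"
  assumes "open U" "x \<in> U" "\<And>y. y \<in> U \<Longrightarrow> f y = c"
  shows "gradient f x = 0"
proof -
  have "((\<lambda>_. c) has_derivative (\<lambda>_. 0)) (at x)" by simp
  then have "(f has_derivative (\<lambda>_. 0)) (at x)"
    by (rule has_derivative_transform_within_open[OF _ assms(1,2)]) (simp add: assms(3))
  then show ?thesis by (simp add: gradient_eqI)
qed

lemma flat_exp_pos_iff [simp]: "0 < flat_exp 0 t \<longleftrightarrow> 0 < t"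
  by (simp add: flat_exp_def)

lemma flat_exp_nonpos: "t \<le> 0 \<Longrightarrow> flat_exp k t = 0"
  by (simp add: flat_exp_def)

lemma flat_exp_0_mono: "s \<le> t \<Longrightarrow> flat_exp 0 s \<le> flat_exp 0 t"
  by (auto simp: flat_exp_def intro: divide_left_mono)

lemma continuous_gradient:
  assumes "Ck 1 f"
  shows "continuous_on UNIV (gradient f)"
  unfolding gradient_def using assms
  by (auto intro!: continuous_intros)

text \<open>Nesting \<open>flat_exp 0\<close> gives a bump without quotients of functions: the inner occurrence
vanishes on the unit ball and is at least \<open>flat_exp 0 1\<close> where \<open>norm z \<ge> sqrt
2\<close>, so that the outer one has a constant positive value on the unit ball and vanishes where
\<open>norm z \<ge> sqrt 2\<close>.\<close>

definition plateau :: "'a::euclidean_space \<Rightarrow> real" where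
  "plateau z = flat_exp 0 (flat_exp 0 1 - flat_exp 0 (z \<bullet> z - 1)) / flat_exp 0 (flat_exp 0 1)"

lemma plateau_inside: "norm z < 1 \<Longrightarrow> plateau z = 1"
proof -
  assume "norm z < 1"
  then have "z \<bullet> z \<le> 1" by (simp add: dot_square_norm power_le_one)
  moreover have "flat_exp 0 (flat_exp 0 1) > 0" by simp
  ultimately show ?thesis by (simp add: plateau_def flat_exp_nonpos order_less_imp_not_eq2)
qed

lemma plateau_outside: "3 / 2 < norm z \<Longrightarrow> plateau z = 0"
proof -
  assume "3 / 2 < norm z"
  then have "(3/2)\<^sup>2 \<le> (norm z)\<^sup>2" by (intro power_mono) auto
  then have "1 \<le> z \<bullet> z - 1" by (simp add: dot_square_norm power2_eq_square)
  from flat_exp_0_mono[OF this] show ?thesis by (simp add: plateau_def flat_exp_nonpos)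
qed

lemma plateau_scaled_smooth: "(\<lambda>y. plateau ((y - x) /\<^sub>R R)) \<in> smooth_term"
proof -
  let ?c = "flat_exp 0 1"
  have "(\<lambda>y. (1 / flat_exp 0 ?c) *
      flat_exp 0 (?c + (-1) * flat_exp 0 ((1 / R\<^sup>2) * ((y - x) \<bullet> (y - x)) + (-1)))) \<in> smooth_term"
    by (intro smooth_term.intros)
  then show ?thesis
    by (simp add: plateau_def power2_eq_square divide_inverse mult_ac)
qed

text \<open>One constant serves all balls, because the functions are translated and scaled copies of a single
one. Its support lies well inside the ball of radius \<open>2\<close>, so the gradient already
vanishes on the boundary of that ball.\<close>

lemma cutoff_functions:
  obtains L where "0 < L"
    "\<And>(x::'a::euclidean_space) R. 0 < R \<Longrightarrow> \<exists>f\<in>C0_infty. (\<forall>y\<in>ball x R. f y = 1) \<and>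
        (\<forall>y. norm (gradient f y) \<le> L / R * indicator (ball x (2 * R) - ball x R) y)"
proof -
  have sm: "(plateau :: 'a \<Rightarrow> real) \<in> smooth_term"
    using plateau_scaled_smooth[where x = 0 and R = 1] by simp
  have "continuous_on (cball 0 2) (gradient (plateau :: 'a \<Rightarrow> real))"
    using continuous_gradient[OF smooth_term_Ck[OF sm]] continuous_on_subset by blast
  then have "bounded (gradient plateau ` cball (0::'a) 2)"
    by (intro compact_imp_bounded compact_continuous_image) auto
  then obtain L where L: "0 < L" "\<And>z::'a. norm z \<le> 2 \<Longrightarrow> norm (gradient plateau z) \<le> L"
    unfolding bounded_pos by auto
  have "\<exists>f\<in>C0_infty. (\<forall>y\<in>ball x R. f y = 1) \<and>
        (\<forall>y. norm (gradient f y) \<le> L / R * indicator (ball x (2 * R) - ball x R) y)"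
    if R: "0 < R" for x :: 'a and R
  proof (intro bexI conjI ballI allI)
    define f where "f y = plateau ((y - x) /\<^sub>R R)" for y
    have nrm: "norm ((y - x) /\<^sub>R R) = dist x y / R" for y
      using R by (simp add: dist_norm norm_minus_commute divide_inverse mult.commute)
    have smf: "f \<in> smooth_term"
      unfolding f_def by (rule plateau_scaled_smooth)
    have supp: "{y. f y \<noteq> 0} \<subseteq> cball x (3 / 2 * R)"
    proof
      fix y assume "y \<in> {y. f y \<noteq> 0}"
      then have "\<not> 3 / 2 < dist x y / R"
        using plateau_outside[of "(y - x) /\<^sub>R R"] unfolding nrm by (auto simp: f_def)
      then show "y \<in> cball x (3 / 2 * R)" using R by (simp add: field_simps)
    qed
    have "compact (closure {y. f y \<noteq> 0})"
      using bounded_subset[OF bounded_cball supp] by (simp add: compact_closure)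
    with smooth_term_Ck[OF smf] show "f \<in> C0_infty"
      by (simp add: C0_infty_def)
    show one: "f y = 1" if "y \<in> ball x R" for y
      using that R plateau_inside[of "(y - x) /\<^sub>R R"] unfolding nrm by (simp add: f_def)
    show "norm (gradient f y) \<le> L / R * indicator (ball x (2 * R) - ball x R) y" for y
    proof -
      consider "y \<in> ball x R" | "3 / 2 * R < dist x y" | "R \<le> dist x y" "dist x y \<le> 3 / 2 * R"
        by fastforce
      then show ?thesis
      proof cases
        case 1
        have "gradient f y = 0"
          by (rule gradient_locally_const[OF open_ball 1 one])
        then show ?thesis using L R by simp
      next
        case 2
        have "f z = 0" if "z \<in> - cball x (3 / 2 * R)" for z
          using supp that by auto
        then have "gradient f y = 0"
          using 2 by (intro gradient_locally_const[of "- cball x (3 / 2 * R)" _ _ 0]) auto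
        then show ?thesis using L R by simp
      next
        case 3
        let ?z = "(y - x) /\<^sub>R R"
        from smooth_term_derivative[OF sm] obtain D where
          D: "(plateau has_derivative D) (at ?z)" by blast
        have "((\<lambda>y. (y - x) /\<^sub>R R) has_derivative (\<lambda>v. v /\<^sub>R R)) (at y)"
          by (auto intro!: derivative_eq_intros)
        from has_derivative_compose[OF this D]
        have "(f has_derivative (\<lambda>v. D (v /\<^sub>R R))) (at y)"
          by (simp add: f_def[abs_def])
        then have "gradient f y = (\<Sum>b\<in>Basis. D (b /\<^sub>R R) *\<^sub>R b)"
          by (rule gradient_eqI)
        also have "\<dots> = gradient plateau ?z /\<^sub>R R"
          using linear_scale[OF has_derivative_linear[OF D]]
          by (simp add: gradient_eqI[OF D] scaleR_sum_right)
        finally have "norm (gradient f y) = norm (gradient plateau ?z) / R"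
          using R by (simp add: divide_inverse mult.commute)
        also have "\<dots> \<le> L / R"
          using 3 R by (intro divide_right_mono L(2)) (simp_all only: nrm, simp_all add: field_simps)
        finally show ?thesis using 3 R by simp
      qed
    qed
  qed
  with L(1) show thesis by (rule that)
qed

section \<open>Measures with a power of the distance as density\<close>

lemma le_ennreal_powr_of_epowr_le:
  assumes "0 < a" "0 \<le> y" "epowr A a \<le> ennreal y"
  shows "A \<le> ennreal (y powr (1 / a))"
proof (cases A)
  case (real t)
  show ?thesis
  proof (cases "t = 0")
    case False
    with real assms have "t powr a \<le> y"
      by (simp add: epowr_def ennreal_le_iff)
    then have "(t powr a) powr (1 / a) \<le> y powr (1 / a)"
      using assms by (intro powr_mono2) auto
    with assms real show ?thesis by (simp add: powr_powr)
  qed (use real in simp)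
next
  case top
  with assms show ?thesis by (simp add: epowr_def top_unique)
qed

lemma epowr_le_ennreal_powr:
  assumes "0 < a" "0 \<le> t" "A \<le> ennreal t"
  shows "epowr A a \<le> ennreal (t powr a)"
proof (cases A)
  case (real s)
  with assms have "s powr a \<le> t powr a"
    by (intro powr_mono2) (auto simp: ennreal_le_iff)
  with real assms show ?thesis by (auto simp: epowr_def ennreal_leI)
qed (use assms in \<open>auto simp: top_unique\<close>)

definition dist_weight :: "'a::euclidean_space set \<Rightarrow> real \<Rightarrow> 'a \<Rightarrow> ennreal" where
  "dist_weight E a x = epowr (ennreal (infdist x E)) a"

definition dist_measure :: "'a::euclidean_space set \<Rightarrow> real \<Rightarrow> 'a measure" where
  "dist_measure E a = density lborel (dist_weight E a)"

lemma dist_weight_neg: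
  "a < 0 \<Longrightarrow> dist_weight E a x = (if infdist x E = 0 then \<infinity> else ennreal (infdist x E powr a))"
  using infdist_nonneg[of x E] by (simp add: dist_weight_def epowr_def)

lemma borel_measurable_dist_weight:
  assumes "a < 0"
  shows "dist_weight E a \<in> borel_measurable borel"
proof -
  have [measurable]: "(\<lambda>x. infdist x E) \<in> borel_measurable borel"
    by (intro borel_measurable_continuous_onI continuous_intros)
  show ?thesis
    unfolding dist_weight_neg[OF assms, abs_def] by measurable
qed

lemma sets_dist_measure [simp]: "sets (dist_measure E a) = sets borel"
  by (simp add: dist_measure_def)

lemma emeasure_dist_measure:
  assumes "a < 0" "A \<in> sets borel"
  shows "emeasure (dist_measure E a) A = (\<integral>\<^sup>+ x. dist_weight E a x * indicator A x \<partial>lborel)"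
  unfolding dist_measure_def using assms borel_measurable_dist_weight[OF assms(1)]
  by (intro emeasure_density) auto

text \<open>Test functions equal to \<open>1\<close> on a ball turn the inequality into a comparison of the two
weighted measures: the left side is at least the mass of the ball, and the right side only sees the
annulus that carries the gradient.\<close>

lemma Hardy_Sobolev_on_balls:
  fixes E :: "'a::euclidean_space set"
  assumes "0 < p" "0 < q" "u < 0" "\<beta> < 0" "0 < C"
    and HS: "\<And>f :: 'a \<Rightarrow> real. f \<in> C0_infty \<Longrightarrow>
        epowr (\<integral>\<^sup>+ x. ennreal (\<bar>f x\<bar> powr q) * dist_weight E u x \<partial>lborel) (1 / q)
        \<le> ennreal C *
          epowr (\<integral>\<^sup>+ x. ennreal (norm (gradient f x) powr p) * dist_weight E \<beta> x \<partial>lborel) (1 / p)"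
  obtains K where "0 < K"
    "\<And>x R b. 0 < R \<Longrightarrow> 0 \<le> b \<Longrightarrow>
        emeasure (dist_measure E \<beta>) (ball x (2 * R) - ball x R) \<le> ennreal b \<Longrightarrow>
        emeasure (dist_measure E u) (ball x R) \<le> ennreal ((K / R * b powr (1 / p)) powr q)"
proof -
  obtain L where L: "0 < L"
    "\<And>(x::'a) R. 0 < R \<Longrightarrow> \<exists>f\<in>C0_infty. (\<forall>y\<in>ball x R. f y = 1) \<and>
        (\<forall>y. norm (gradient f y) \<le> L / R * indicator (ball x (2 * R) - ball x R) y)"
    using cutoff_functions by metis
  have "emeasure (dist_measure E u) (ball x R) \<le> ennreal ((C * L / R * b powr (1 / p)) powr q)"
    if R: "0 < R" and b: "0 \<le> b"
      and nu: "emeasure (dist_measure E \<beta>) (ball x (2 * R) - ball x R) \<le> ennreal b" for x R b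
  proof -
    let ?S = "ball x (2 * R) - ball x R"
    obtain f where f: "f \<in> C0_infty" "\<And>y. y \<in> ball x R \<Longrightarrow> f y = 1"
      "\<And>y. norm (gradient f y) \<le> L / R * indicator ?S y"
      using L(2)[OF R] by blast
    let ?A = "\<integral>\<^sup>+ y. ennreal (\<bar>f y\<bar> powr q) * dist_weight E u y \<partial>lborel"
    let ?B = "\<integral>\<^sup>+ y. ennreal (norm (gradient f y) powr p) * dist_weight E \<beta> y \<partial>lborel"
    have "?B \<le> (\<integral>\<^sup>+ y. ennreal ((L / R) powr p) * (dist_weight E \<beta> y * indicator ?S y) \<partial>lborel)"
    proof (rule nn_integral_mono)
      fix y
      have "norm (gradient f y) powr p \<le> (L / R * indicator ?S y) powr p"
        using f(3) assms(1) by (intro powr_mono2) auto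
      also have "\<dots> = (L / R) powr p * indicator ?S y"
        by (simp add: indicator_def)
      finally have "ennreal (norm (gradient f y) powr p) \<le> ennreal ((L / R) powr p) * indicator ?S y"
        by (auto simp: indicator_def ennreal_leI split: if_splits)
      from mult_right_mono[OF this]
      show "ennreal (norm (gradient f y) powr p) * dist_weight E \<beta> y
          \<le> ennreal ((L / R) powr p) * (dist_weight E \<beta> y * indicator ?S y)"
        by (simp add: mult_ac)
    qed
    also have "\<dots> = ennreal ((L / R) powr p) * emeasure (dist_measure E \<beta>) ?S"
      using borel_measurable_dist_weight[OF \<open>\<beta> < 0\<close>, of E]
      by (subst nn_integral_cmult)
         (auto simp: emeasure_dist_measure[OF \<open>\<beta> < 0\<close>]
           intro!: borel_measurable_times_ennreal borel_measurable_indicator)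
    also have "\<dots> \<le> ennreal ((L / R) powr p) * ennreal b"
      by (intro mult_left_mono nu) simp
    also have "\<dots> = ennreal ((L / R) powr p * b)"
      using b by (simp add: ennreal_mult)
    finally have "epowr ?B (1 / p) \<le> ennreal (((L / R) powr p * b) powr (1 / p))"
      using assms(1) b by (intro epowr_le_ennreal_powr) auto
    also have "((L / R) powr p * b) powr (1 / p) = L / R * b powr (1 / p)"
      using assms(1) b L R by (simp add: powr_mult powr_powr)
    finally have "ennreal C * epowr ?B (1 / p) \<le> ennreal C * ennreal (L / R * b powr (1 / p))"
      by (intro mult_left_mono) auto
    also have "\<dots> = ennreal (C * L / R * b powr (1 / p))"
      using assms(5) L R by (simp add: ennreal_mult[symmetric])
    finally have "epowr ?A (1 / q) \<le> ennreal (C * L / R * b powr (1 / p))"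
      using HS[OF f(1)] by (rule order_trans[rotated])
    then have A: "?A \<le> ennreal ((C * L / R * b powr (1 / p)) powr (1 / (1 / q)))"
      using assms L R by (intro le_ennreal_powr_of_epowr_le) auto
    have "emeasure (dist_measure E u) (ball x R) \<le> ?A"
      unfolding emeasure_dist_measure[OF \<open>u < 0\<close> borel_open[OF open_ball]]
      by (intro nn_integral_mono) (auto simp: indicator_def f(2))
    with A show ?thesis by simp
  qed
  then show thesis using that[of "C * L"] assms L by simp
qed

text \<open>Enlarge the ball until the annulus around it has distance at least \<open>1\<close> from
\<open>E\<close>; there the weight with exponent \<open>\<beta>\<close> is at most \<open>1\<close>.\<close>

lemma dist_measure_ball_finite:
  fixes E :: "'a::euclidean_space set"
  assumes "bounded E" "E \<noteq> {}" "u < 0" "\<beta> < 0"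
    and HS: "\<And>x R b. 0 < R \<Longrightarrow> 0 \<le> b \<Longrightarrow>
        emeasure (dist_measure E \<beta>) (ball x (2 * R) - ball x R) \<le> ennreal b \<Longrightarrow>
        emeasure (dist_measure E u) (ball x R) \<le> ennreal ((K / R * b powr (1 / p)) powr q)"
  shows "emeasure (dist_measure E u) (ball x r) < \<infinity>"
proof -
  obtain r0 where r0: "E \<subseteq> ball x r0"
    using bounded_subset_ballD[OF \<open>bounded E\<close>] by metis
  define R where "R = max (max r 0) r0 + 1"
  have "0 < R" by (simp add: R_def)
  let ?S = "ball x (2 * R) - ball x R"
  have far: "1 \<le> infdist y E" if "y \<in> ?S" for y
    unfolding infdist_notempty[OF \<open>E \<noteq> {}\<close>]
  proof (rule cINF_greatest[OF \<open>E \<noteq> {}\<close>])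
    fix z assume "z \<in> E"
    with r0 have "dist x z < r0" by auto
    moreover have "r0 + 1 \<le> dist x y" using that by (auto simp: R_def)
    ultimately show "1 \<le> dist y z" using dist_triangle[of x y z] by (simp add: dist_commute)
  qed
  have "dist_weight E \<beta> y \<le> 1" if "y \<in> ?S" for y
    using far[OF that] \<open>\<beta> < 0\<close> powr_mono2'[of \<beta> 1 "infdist y E"]
    by (auto simp: dist_weight_neg)
  then have "emeasure (dist_measure E \<beta>) ?S \<le> (\<integral>\<^sup>+ y. indicator (ball x (2 * R)) y \<partial>lborel)"
    unfolding emeasure_dist_measure[OF \<open>\<beta> < 0\<close> sets.Diff[OF borel_open[OF open_ball] borel_open[OF open_ball]]]
    by (intro nn_integral_mono) (auto simp: indicator_def)
  also have "\<dots> = ennreal (unit_ball_vol DIM('a) * (2 * R) ^ DIM('a))"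
    using \<open>0 < R\<close> by (simp add: emeasure_ball)
  finally have "emeasure (dist_measure E u) (ball x R)
      \<le> ennreal ((K / R * (unit_ball_vol DIM('a) * (2 * R) ^ DIM('a)) powr (1 / p)) powr q)"
    using \<open>0 < R\<close> by (intro HS) (auto intro: less_imp_le)
  moreover have "emeasure (dist_measure E u) (ball x r) \<le> emeasure (dist_measure E u) (ball x R)"
    by (intro emeasure_mono) (auto simp: R_def)
  ultimately show ?thesis
    by (metis ennreal_less_top infinity_ennreal_def le_less_trans)
qed

text \<open>Pointwise, \<open>t^(-b)\<close> is at most \<open>k^(-b)\<close> if \<open>t \<ge> k\<close>, and
at most \<open>k^(a-b) t^(-a)\<close> otherwise. With \<open>k\<close> free to be optimised, this
replaces the Hoelder inequality.\<close>

lemma dist_measure_interpolation: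
  fixes E :: "'a::euclidean_space set"
  assumes "0 < b" "b < a" "0 < k" "B \<in> sets borel"
  shows "emeasure (dist_measure E (- b)) B
      \<le> ennreal (k powr - b) * emeasure lborel B
        + ennreal (k powr (a - b)) * emeasure (dist_measure E (- a)) B"
proof -
  have pt: "dist_weight E (- b) x \<le> ennreal (k powr - b) + ennreal (k powr (a - b)) * dist_weight E (- a) x"
    for x
  proof (cases "infdist x E = 0")
    case True
    then show ?thesis using assms by (simp add: dist_weight_neg ennreal_mult_top)
  next
    case False
    then have t: "0 < infdist x E" using infdist_nonneg[of x E] by simp
    have "infdist x E powr - b \<le> k powr - b + k powr (a - b) * infdist x E powr - a"
    proof (cases "k \<le> infdist x E")
      case True
      then have "infdist x E powr - b \<le> k powr - b"
        using assms by (intro powr_mono2') auto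
      then show ?thesis by (simp add: add_increasing2)
    next
      case False
      have "infdist x E powr - b = infdist x E powr (a - b) * infdist x E powr - a"
        by (simp add: powr_add[symmetric])
      also have "\<dots> \<le> k powr (a - b) * infdist x E powr - a"
        using False t assms by (intro mult_right_mono powr_mono2) auto
      finally show ?thesis by (simp add: add_increasing)
    qed
    then show ?thesis
      using False assms by (simp add: dist_weight_neg flip: ennreal_mult ennreal_plus)
  qed
  have meas: "dist_weight E (- a) \<in> borel_measurable borel"
    using assms by (intro borel_measurable_dist_weight) auto
  have "emeasure (dist_measure E (- b)) B
      = (\<integral>\<^sup>+ x. dist_weight E (- b) x * indicator B x \<partial>lborel)"
    using assms by (intro emeasure_dist_measure) auto
  also have "\<dots> \<le> (\<integral>\<^sup>+ x. ennreal (k powr - b) * indicator B x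
      + ennreal (k powr (a - b)) * (dist_weight E (- a) x * indicator B x) \<partial>lborel)"
    by (intro nn_integral_mono) (auto simp: indicator_def pt)
  also have "\<dots> = ennreal (k powr - b) * emeasure lborel B
        + ennreal (k powr (a - b)) * (\<integral>\<^sup>+ x. dist_weight E (- a) x * indicator B x \<partial>lborel)"
    using assms meas by (simp add: nn_integral_add nn_integral_cmult nn_integral_cmult_indicator)
  also have "(\<integral>\<^sup>+ x. dist_weight E (- a) x * indicator B x \<partial>lborel) = emeasure (dist_measure E (- a)) B"
    using assms by (intro emeasure_dist_measure[symmetric]) auto
  finally show ?thesis .
qed

section \<open>Growth of the singular measure on small balls\<close>

lemma self_improving_constant:
  fixes c g :: real
  assumes "0 < c" "g < 1" "1 \<le> M" "c powr (1 / (1 - g)) \<le> M"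
  shows "c * M powr g \<le> M"
proof -
  have "c = (c powr (1 / (1 - g))) powr (1 - g)"
    using assms by (simp add: powr_powr)
  also have "\<dots> \<le> M powr (1 - g)"
    using assms by (intro powr_mono2) auto
  finally have "c * M powr g \<le> M powr (1 - g) * M powr g"
    by (intro mult_right_mono) auto
  also have "\<dots> = M"
    using assms by (simp flip: powr_add)
  finally show ?thesis .
qed

text \<open>The normalised masses \<open>m(R) = R^(a-N) \<mu>(ball x R)\<close> of a ball centred in
\<open>E\<close> satisfy \<open>m(R) \<le> c M^g\<close> whenever \<open>m(2R) \<le> M\<close> and
\<open>M \<ge> 1\<close>, where \<open>g = b q / (a p)\<close>. As \<open>g < 1\<close>, a
sufficiently large bound \<open>M\<close> at scale \<open>2R\<close> reproduces itself at scale
\<open>R\<close>, and hence passes from the scales between \<open>D\<close> and \<open>2D\<close>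
down to all smaller ones.\<close>

lemma dist_measure_growth:
  fixes E :: "'a::euclidean_space set"
  defines "N \<equiv> real DIM('a)"
  assumes "bounded E" "E \<noteq> {}" "0 < b" "b < a" "0 < p" "0 < q" "0 < K" "0 < D"
    and s: "q / p * (N - p - b) = N - a"
    and gain: "b * q < a * p"
    and HS: "\<And>x R t. 0 < R \<Longrightarrow> 0 \<le> t \<Longrightarrow>
        emeasure (dist_measure E (- b)) (ball x (2 * R) - ball x R) \<le> ennreal t \<Longrightarrow>
        emeasure (dist_measure E (- a)) (ball x R) \<le> ennreal ((K / R * t powr (1 / p)) powr q)"
  obtains M where "0 < M"
    "\<And>x R. x \<in> E \<Longrightarrow> 0 < R \<Longrightarrow> R < 2 * D \<Longrightarrow>
       emeasure (dist_measure E (- a)) (ball x R) \<le> ennreal (M * R powr (N - a))"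
proof -
  define \<omega> where "\<omega> = unit_ball_vol N"
  have \<omega>: "0 < \<omega>" by (simp add: \<omega>_def N_def)
  define c where "c = (K * ((\<omega> + 1) * 2 powr (N - b)) powr (1 / p)) powr q"
  define g where "g = b * q / (a * p)"
  have g: "g < 1" and c: "0 < c"
    using assms \<omega> by (auto simp: g_def c_def)
  \<comment> \<open>At the starting scales, one fixed large ball of finite mass contains all balls in question.\<close>
  obtain x0 r0 where r0: "E \<subseteq> ball x0 r0"
    using bounded_subset_ballD[OF \<open>bounded E\<close>] by metis
  let ?U = "ball x0 (r0 + 2 * D)"
  have "emeasure (dist_measure E (- a)) ?U < \<infinity>"
    using assms(2-5) by (intro dist_measure_ball_finite[of E "- a" "- b", OF _ _ _ _ HS]) auto
  then obtain I where I: "0 \<le> I" "emeasure (dist_measure E (- a)) ?U = ennreal I"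
    by (metis ennreal_cases infinity_ennreal_def less_irrefl)
  \<comment> \<open>The sign of \<open>N - a\<close> is still unknown, so either end of the range of radii can give the
    minimum.\<close>
  define m where "m = min (D powr (N - a)) ((2 * D) powr (N - a))"
  have m: "0 < m" using \<open>0 < D\<close> by (simp add: m_def)
  have mR: "m \<le> R powr (N - a)" if "D \<le> R" "R < 2 * D" for R
  proof (cases "0 \<le> N - a")
    case True
    then have "D powr (N - a) \<le> R powr (N - a)"
      using that \<open>0 < D\<close> by (intro powr_mono2) auto
    then show ?thesis by (simp add: m_def)
  next
    case False
    then have "(2 * D) powr (N - a) \<le> R powr (N - a)"
      using that \<open>0 < D\<close> by (intro powr_mono2') auto
    then show ?thesis by (simp add: m_def)
  qed
  define M where "M = max 1 (max (c powr (1 / (1 - g))) (I / m))"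
  have M: "1 \<le> M" "c powr (1 / (1 - g)) \<le> M" "I / m \<le> M"
    by (auto simp: M_def)
  have large: "emeasure (dist_measure E (- a)) (ball x R) \<le> ennreal (M * R powr (N - a))"
    if "x \<in> E" "D \<le> R" "R < 2 * D" for x R
  proof -
    have "ball x R \<subseteq> ?U"
    proof
      fix y assume "y \<in> ball x R"
      moreover have "dist x0 x < r0" using that r0 by auto
      ultimately show "y \<in> ?U"
        using dist_triangle[of x0 y x] that by auto
    qed
    then have "emeasure (dist_measure E (- a)) (ball x R) \<le> ennreal I"
      unfolding I(2)[symmetric] by (intro emeasure_mono) auto
    also have "I \<le> M * m"
      using M(3) m by (simp add: field_simps)
    then have "ennreal I \<le> ennreal (M * R powr (N - a))"
      using mult_left_mono[OF mR[OF that(2,3)], of M] M(1) by (intro ennreal_leI) linarith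
    finally show ?thesis .
  qed
  have "emeasure (dist_measure E (- a)) (ball x R) \<le> ennreal (M * R powr (N - a))"
    if "x \<in> E" "0 < R" "R < 2 * D" "D \<le> 2 ^ i * R" for x R i
    using that
  proof (induction i arbitrary: R)
    case 0
    then show ?case using large by simp
  next
    case (Suc i)
    show ?case
    proof (cases "D \<le> R")
      case True
      then show ?thesis using large Suc.prems by blast
    next
      case False
      define r where "r = 2 * R"
      have r: "0 < r" using Suc.prems by (simp add: r_def)
      have IH: "emeasure (dist_measure E (- a)) (ball x r) \<le> ennreal (M * r powr (N - a))"
        unfolding r_def using Suc.prems False by (intro Suc.IH) (auto simp: mult_ac)
      \<comment> \<open>This choice makes the two terms of the interpolation comparable.\<close>
      define k where "k = M powr (- 1 / a) * r"
      have k: "0 < k" using M r by (simp add: k_def)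
      have k1: "k powr - b = M powr (b / a) * r powr - b"
        using M r by (simp add: k_def powr_mult powr_powr)
      have k2: "k powr (a - b) * M = M powr (b / a) * r powr (a - b)"
      proof -
        have "M powr (- ((a - b) / a)) * M powr 1 = M powr (b / a)"
          using assms(4,5) by (subst powr_add[symmetric]) (simp add: field_simps)
        moreover have "k powr (a - b) = M powr (- ((a - b) / a)) * r powr (a - b)"
          using M r by (simp add: k_def powr_mult powr_powr)
        ultimately show ?thesis using M by (simp add: mult_ac)
      qed
      define t where "t = (\<omega> + 1) * (M powr (b / a) * r powr (N - b))"
      have "emeasure (dist_measure E (- b)) (ball x (2 * R) - ball x R)
          \<le> emeasure (dist_measure E (- b)) (ball x r)"
        by (intro emeasure_mono) (auto simp: r_def)
      also have "\<dots> \<le> ennreal (k powr - b) * emeasure lborel (ball x r)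
          + ennreal (k powr (a - b)) * emeasure (dist_measure E (- a)) (ball x r)"
        using assms k by (intro dist_measure_interpolation) auto
      also have "\<dots> \<le> ennreal (k powr - b) * ennreal (\<omega> * r powr N)
          + ennreal (k powr (a - b)) * ennreal (M * r powr (N - a))"
        using IH r by (intro add_mono mult_left_mono)
          (auto simp: emeasure_ball \<omega>_def N_def powr_realpow)
      also have "\<dots> = ennreal (k powr - b * (\<omega> * r powr N) + k powr (a - b) * (M * r powr (N - a)))"
        using M \<omega> by (simp flip: ennreal_mult ennreal_plus)
      also have "k powr - b * (\<omega> * r powr N) = \<omega> * (M powr (b / a) * (r powr - b * r powr N))"
        by (simp add: k1 mult_ac)
      also have "r powr - b * r powr N = r powr (N - b)"
        by (simp add: powr_add[symmetric])
      also have "k powr (a - b) * (M * r powr (N - a)) = (k powr (a - b) * M) * r powr (N - a)"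
        by simp
      also have "\<dots> = M powr (b / a) * (r powr (a - b) * r powr (N - a))"
        by (simp add: k2)
      also have "r powr (a - b) * r powr (N - a) = r powr (N - b)"
        by (simp add: powr_add[symmetric])
      also have "\<omega> * (M powr (b / a) * r powr (N - b)) + M powr (b / a) * r powr (N - b) = t"
        by (simp add: t_def algebra_simps)
      finally have "emeasure (dist_measure E (- a)) (ball x R)
          \<le> ennreal ((K / R * t powr (1 / p)) powr q)"
        using Suc.prems \<omega> by (intro HS) (auto simp: t_def)
      also have "(K / R * t powr (1 / p)) powr q = c * M powr g * R powr (N - a)"
      proof -
        have t: "t = ((\<omega> + 1) * 2 powr (N - b)) * (M powr (b / a) * R powr (N - b))"
          using Suc.prems by (simp add: t_def r_def powr_mult mult_ac)
        have "K / R * t powr (1 / p)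
            = (K * ((\<omega> + 1) * 2 powr (N - b)) powr (1 / p))
              * (M powr (b / a / p) * (R powr ((N - b) / p) * R powr (- 1)))"
          unfolding t using Suc.prems \<omega> M
          by (simp add: powr_mult powr_powr powr_minus_divide)
        also have "R powr ((N - b) / p) * R powr (- 1) = R powr ((N - p - b) / p)"
          using \<open>0 < p\<close> by (subst powr_add[symmetric]) (simp add: field_simps)
        finally have "(K / R * t powr (1 / p)) powr q
            = c * (M powr (b / a / p * q) * R powr ((N - p - b) / p * q))"
          using \<open>0 < K\<close> \<omega> by (simp add: c_def powr_mult powr_powr)
        moreover have "b / a / p * q = g" by (simp add: g_def)
        moreover have "(N - p - b) / p * q = N - a" using s by (simp add: mult.commute)
        ultimately show ?thesis by simp
      qed
      also have "ennreal (c * M powr g * R powr (N - a)) \<le> ennreal (M * R powr (N - a))"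
        using self_improving_constant[OF c g M(1,2)] by (intro ennreal_leI mult_right_mono) auto
      finally show ?thesis .
    qed
  qed
  moreover have "\<exists>i. D \<le> 2 ^ i * R" if "0 < R" for R
    using real_arch_pow[of 2 "D / R"] that by (auto simp: field_simps intro: less_imp_le)
  ultimately show thesis
    using that[of M] M(1) by (meson less_le_trans zero_less_one)
qed

section \<open>Packing sums over many scales\<close>

definition separated :: "real \<Rightarrow> 'a::metric_space set \<Rightarrow> bool" where
  "separated r F \<longleftrightarrow> (\<forall>x\<in>F. \<forall>y\<in>F. x \<noteq> y \<longrightarrow> r \<le> dist x y)"

lemma separated_mono: "separated r F \<Longrightarrow> r' \<le> r \<Longrightarrow> F' \<subseteq> F \<Longrightarrow> separated r' F'"
  unfolding separated_def by (meson order_trans subsetD)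

text \<open>A separated set of maximal cardinality cannot be enlarged, hence it is a net.\<close>

lemma ex_separated_net:
  assumes "0 < r"
    and bound: "\<And>F. finite F \<Longrightarrow> F \<subseteq> A \<Longrightarrow> separated r F \<Longrightarrow> real (card F) \<le> K"
  obtains F where "finite F" "F \<subseteq> A" "separated r F" "A \<subseteq> (\<Union>x\<in>F. ball x r)"
proof -
  let ?P = "\<lambda>F. finite F \<and> F \<subseteq> A \<and> separated r F"
  obtain m where m: "K < real m" using reals_Archimedean2 by blast
  have "\<forall>F. ?P F \<longrightarrow> card F < m"
    using bound m by (meson of_nat_less_iff order_le_less_trans)
  moreover have "?P {}" by (simp add: separated_def)
  ultimately obtain F where F: "?P F" "\<And>G. ?P G \<Longrightarrow> card G \<le> card F"
    using ex_has_greatest_nat[of ?P "{}" card] by metis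
  have "z \<in> (\<Union>x\<in>F. ball x r)" if "z \<in> A" for z
  proof (rule ccontr)
    assume "z \<notin> (\<Union>x\<in>F. ball x r)"
    then have far: "\<And>x. x \<in> F \<Longrightarrow> r \<le> dist x z" by force
    then have "z \<notin> F" using \<open>0 < r\<close> by force
    moreover have "?P (insert z F)"
      using F(1) far that by (auto simp: separated_def dist_commute)
    ultimately show False using F(1) F(2)[of "insert z F"] by simp
  qed
  with F(1) that show thesis by blast
qed

text \<open>Next to each point of \<open>F j\<close>, porosity yields a ball of radius comparable to \<open>(c /
4)^j R\<close> on which the distance to \<open>E\<close> is comparable to that number as well. The
balls at one scale are disjoint by separation, and those at different scales because the distance to
\<open>E\<close> takes values in disjoint ranges. Hence their masses add up to at most the mass of
\<open>ball x (2 * R)\<close>. The point is that the bound is the same for every number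
\<open>J\<close> of scales.\<close>

lemma dist_measure_packing:
  fixes E :: "'a::euclidean_space set"
  defines "N \<equiv> real DIM('a)"
  assumes "0 < a" "0 < c" "c < 1"
    and porous: "\<And>z r. z \<in> E \<Longrightarrow> 0 < r \<Longrightarrow> r < D \<Longrightarrow> \<exists>y. ball y (c * r) \<subseteq> ball z r - E"
    and growth: "\<And>z r. z \<in> E \<Longrightarrow> 0 < r \<Longrightarrow> r < 2 * D \<Longrightarrow>
       emeasure (dist_measure E (- a)) (ball z r) \<le> ennreal (M * r powr (N - a))"
    and x: "x \<in> E" and R: "0 < R" "R < D" and "0 < M"
    and F: "\<And>j. j \<in> {1..J} \<Longrightarrow>
      finite (F j) \<and> F j \<subseteq> E \<inter> ball x R \<and> separated ((c / 4) ^ j * R) (F j)"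
  shows "(\<Sum>j=1..J. real (card (F j)) * ((c / 4) ^ j) powr (N - a))
    \<le> M * 2 powr (N - a) / (unit_ball_vol N * (c / 4) powr N)"
proof -
  define \<kappa> where "\<kappa> = c / 4"
  have \<kappa>: "0 < \<kappa>" "\<kappa> < 1" "c = 4 * \<kappa>" using assms by (auto simp: \<kappa>_def)
  define \<omega> where "\<omega> = unit_ball_vol N"
  have \<omega>: "0 < \<omega>" by (simp add: \<omega>_def N_def)
  define \<rho> where "\<rho> j = \<kappa> ^ j * R" for j
  have \<rho>: "0 < \<rho> j" "\<rho> j \<le> R" for j
    using \<kappa> R by (auto simp: \<rho>_def power_le_one mult_le_cancel_right1)
  have \<rho>_less: "\<rho> i \<le> \<kappa> * \<rho> j" if "j < i" for i j
  proof -
    have "\<kappa> ^ i \<le> \<kappa> ^ Suc j" using that \<kappa> by (intro power_decreasing) auto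
    with R show ?thesis by (simp add: \<rho>_def)
  qed
  obtain Y where Y: "\<And>z r. z \<in> E \<Longrightarrow> 0 < r \<Longrightarrow> r < D \<Longrightarrow> ball (Y z r) (c * r) \<subseteq> ball z r - E"
    using porous by metis
  \<comment> \<open>Half of the radius that porosity gives keeps these balls at a distance from \<open>E\<close>.\<close>
  define B where "B = (\<lambda>(j, z). ball (Y z (\<rho> j / 2)) (\<kappa> * \<rho> j))"
  define I where "I = Sigma {1..J} F"
  let ?\<mu> = "dist_measure E (- a)"
  have hole: "\<kappa> * \<rho> j \<le> infdist w E" "infdist w E < \<rho> j" "dist z w < \<rho> j / 2"
    if "(j, z) \<in> I" "w \<in> B (j, z)" for j z w
  proof -
    have z: "z \<in> E" using that F by (auto simp: I_def)
    let ?y = "Y z (\<rho> j / 2)"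
    have sub: "ball ?y (c * (\<rho> j / 2)) \<subseteq> ball z (\<rho> j / 2) - E"
      using Y[OF z, of "\<rho> j / 2"] \<rho>[of j] R by auto
    have w: "dist ?y w < \<kappa> * \<rho> j" using that by (simp add: B_def)
    show "\<kappa> * \<rho> j \<le> infdist w E"
      unfolding infdist_notempty[OF ex_in_conv[THEN iffD1, OF exI, OF z]]
    proof (rule cINF_greatest)
      show "E \<noteq> {}" using z by auto
      fix e assume "e \<in> E"
      with sub have "c * (\<rho> j / 2) \<le> dist ?y e" by (meson Diff_iff mem_ball not_le subsetD)
      then show "\<kappa> * \<rho> j \<le> dist w e"
        using w dist_triangle[of ?y e w] by (simp add: \<kappa>(3))
    qed
    have "0 < \<kappa> * \<rho> j" using \<kappa> \<rho> by simp
    with w have "w \<in> ball ?y (c * (\<rho> j / 2))" by (simp add: \<kappa>(3))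
    with sub show d: "dist z w < \<rho> j / 2" by auto
    then show "infdist w E < \<rho> j"
      using infdist_le[OF z, of w] \<rho>(1)[of j] by (simp add: dist_commute)
  qed
  have "finite I" using F by (auto simp: I_def)
  have disj: "disjoint_family_on B I"
    unfolding disjoint_family_on_def
  proof (intro ballI impI, rule ccontr)
    fix i i' assume i: "i \<in> I" "i' \<in> I" "i \<noteq> i'" "B i \<inter> B i' \<noteq> {}"
    obtain j z j' z' where e: "i = (j, z)" "i' = (j', z')" by fastforce
    from i e obtain w where w: "w \<in> B (j, z)" "w \<in> B (j', z')" by blast
    note h = hole[OF i(1)[unfolded e] w(1)] hole[OF i(2)[unfolded e] w(2)]
    consider "j < j'" | "j' < j" | "j = j'" "z \<noteq> z'" using i e by fastforce
    then show False
    proof cases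
      case 1
      then show ?thesis using h \<rho>_less[of j j'] by linarith
    next
      case 2
      then show ?thesis using h \<rho>_less[of j' j] by linarith
    next
      case 3
      then have "\<rho> j \<le> dist z z'"
        using i e F by (auto simp: I_def separated_def \<rho>_def \<kappa>_def)
      then show ?thesis using h 3 dist_triangle[of z z' w] by (simp add: dist_commute)
    qed
  qed
  have sub: "B i \<subseteq> ball x (2 * R)" if "i \<in> I" for i
  proof
    obtain j z where i: "i = (j, z)" by fastforce
    fix w assume "w \<in> B i"
    with that i have "dist z w < \<rho> j / 2" using hole by blast
    moreover have "z \<in> ball x R" using that i F[of j] by (auto simp: I_def)
    ultimately show "w \<in> ball x (2 * R)"
      using \<rho>[of j] dist_triangle[of x w z] by auto
  qed
  have vol: "ennreal (\<omega> * \<kappa> powr N * R powr (N - a) * (\<kappa> ^ j) powr (N - a)) \<le> emeasure ?\<mu> (B (j, z))"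
    if "(j, z) \<in> I" for j z
  proof -
    have "\<rho> j powr - a * \<rho> j powr N = (\<kappa> ^ j) powr (N - a) * R powr (N - a)"
      using \<kappa> R by (simp add: powr_add[symmetric] powr_mult[symmetric] \<rho>_def)
    then have "ennreal (\<omega> * \<kappa> powr N * R powr (N - a) * (\<kappa> ^ j) powr (N - a))
        = ennreal (\<rho> j powr - a * (\<omega> * (\<kappa> * \<rho> j) powr N))"
      using \<kappa> \<rho>(1)[of j] by (simp add: powr_mult mult_ac)
    also have "\<dots> = ennreal (\<rho> j powr - a) * emeasure lborel (B (j, z))"
      using \<kappa> \<rho>(1)[of j] \<omega>
      by (simp add: B_def emeasure_ball \<omega>_def N_def powr_realpow ennreal_mult)
    also have "\<dots> = (\<integral>\<^sup>+ w. ennreal (\<rho> j powr - a) * indicator (B (j, z)) w \<partial>lborel)"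
      by (intro nn_integral_cmult_indicator[symmetric]) (simp add: B_def)
    also have "\<dots> \<le> (\<integral>\<^sup>+ w. dist_weight E (- a) w * indicator (B (j, z)) w \<partial>lborel)"
    proof (rule nn_integral_mono)
      fix w
      show "ennreal (\<rho> j powr - a) * indicator (B (j, z)) w
          \<le> dist_weight E (- a) w * indicator (B (j, z)) w"
      proof (cases "w \<in> B (j, z)")
        case True
        have "0 < \<kappa> * \<rho> j" using \<kappa> \<rho> by simp
        with hole[OF that True] have "0 < infdist w E" "infdist w E \<le> \<rho> j" by auto
        with \<open>0 < a\<close> have "\<rho> j powr - a \<le> infdist w E powr - a"
          by (intro powr_mono2') auto
        then show ?thesis
          using True \<open>0 < a\<close> \<open>0 < infdist w E\<close> by (simp add: dist_weight_neg ennreal_leI)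
      qed simp
    qed
    also have "\<dots> = emeasure ?\<mu> (B (j, z))"
      using \<open>0 < a\<close> by (intro emeasure_dist_measure[symmetric]) (auto simp: B_def)
    finally show ?thesis .
  qed
  let ?S = "\<Sum>j=1..J. real (card (F j)) * (\<kappa> ^ j) powr (N - a)"
  let ?v = "\<omega> * \<kappa> powr N * R powr (N - a)"
  have "ennreal (?v * ?S) = ennreal (\<Sum>(j, z)\<in>I. ?v * (\<kappa> ^ j) powr (N - a))"
    unfolding I_def using F by (subst sum.Sigma[symmetric]) (auto simp: sum_distrib_left mult_ac)
  also have "\<dots> = (\<Sum>(j, z)\<in>I. ennreal (?v * (\<kappa> ^ j) powr (N - a)))"
    using \<omega> by (subst sum_ennreal[symmetric]) (auto simp: case_prod_unfold)
  also have "\<dots> \<le> (\<Sum>i\<in>I. emeasure ?\<mu> (B i))"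
    using vol by (intro sum_mono) auto
  also have "\<dots> = emeasure ?\<mu> (\<Union>i\<in>I. B i)"
    using \<open>finite I\<close> disj by (intro sum_emeasure) (auto simp: B_def)
  also have "\<dots> \<le> emeasure ?\<mu> (ball x (2 * R))"
    using sub by (intro emeasure_mono) auto
  also have "\<dots> \<le> ennreal (M * (2 * R) powr (N - a))"
    using R x by (intro growth) auto
  finally have "?v * ?S \<le> M * (2 * R) powr (N - a)"
    using \<open>0 < M\<close> by (simp add: ennreal_le_iff)
  then have "R powr (N - a) * (\<omega> * \<kappa> powr N * ?S) \<le> R powr (N - a) * (M * 2 powr (N - a))"
    using R by (simp add: powr_mult mult_ac)
  then have "\<omega> * \<kappa> powr N * ?S \<le> M * 2 powr (N - a)"
    using R by simp
  then have "?S \<le> M * 2 powr (N - a) / (\<omega> * \<kappa> powr N)"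
    using \<omega> \<kappa> by (simp add: field_simps)
  then show ?thesis by (simp add: \<kappa>_def \<omega>_def)
qed

section \<open>A strictly smaller packing exponent\<close>

text \<open>Each term of the sum counts at least one point in the case of singletons, so the sum could not stay
bounded if \<open>s \<le> 0\<close>. For nets, boundedness forces one of the first \<open>J\<close>
terms to be at most \<open>1/2\<close>: every ball is covered by a number \<open>m\<close> of balls
with radii smaller by a factor \<open>\<kappa>^j\<close>, \<open>1 \<le> j \<le> J\<close>, where
\<open>m \<kappa>^(j s) \<le> 1/2\<close>. The factor \<open>1/2\<close> pays for a slightly smaller
exponent \<open>l\<close> with \<open>m \<kappa>^(j l) \<le> 1\<close>, and iterating such covers
bounds the cardinality of separated sets with exponent \<open>l\<close>.\<close>

lemma packing_exponent_gap:
  fixes E :: "'a::metric_space set"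
  assumes "E \<noteq> {}" "0 < D" "0 < \<kappa>" "\<kappa> < 1"
    and sum_bound: "\<And>x R J F. x \<in> E \<Longrightarrow> 0 < R \<Longrightarrow> R < D \<Longrightarrow>
      (\<And>j. j \<in> {1..J} \<Longrightarrow>
        finite (F j) \<and> F j \<subseteq> E \<inter> ball x R \<and> separated (\<kappa> ^ j * R) (F j)) \<Longrightarrow>
      (\<Sum>j=1..J. real (card (F j)) * (\<kappa> ^ j) powr s) \<le> Q"
  obtains l C where "0 \<le> l" "l < s" "0 < C"
    "\<And>x R r F. x \<in> E \<Longrightarrow> 0 < r \<Longrightarrow> r < R \<Longrightarrow> R < D \<Longrightarrow> finite F \<Longrightarrow>
       F \<subseteq> E \<inter> ball x R \<Longrightarrow> separated r F \<Longrightarrow> real (card F) \<le> C * (R / r) powr l"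
proof -
  obtain J :: nat where "max 0 (2 * Q) < real J"
    using reals_Archimedean2 by blast
  then have J: "2 * Q < real J" "1 \<le> J" by auto
  have "0 < s"
  proof (rule ccontr)
    assume "\<not> 0 < s"
    obtain x where x: "x \<in> E" using assms by auto
    have "real J = (\<Sum>j=1..J. 1)" by simp
    also have "\<dots> \<le> (\<Sum>j=1..J. real (card {x}) * (\<kappa> ^ j) powr s)"
    proof (rule sum_mono)
      fix j
      have "1 powr s \<le> (\<kappa> ^ j) powr s"
        using \<open>\<not> 0 < s\<close> assms by (intro powr_mono2') (auto intro: power_le_one)
      then show "1 \<le> real (card {x}) * (\<kappa> ^ j) powr s" by simp
    qed
    also have "\<dots> \<le> Q"
      using assms x by (intro sum_bound[of x "D / 2"]) (auto simp: separated_def)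
    finally show False using J by linarith
  qed
  have single: "real (card F) * (\<kappa> ^ j) powr s \<le> Q"
    if "x \<in> E" "0 < R" "R < D" "1 \<le> j" "finite F" "F \<subseteq> E \<inter> ball x R" "separated (\<kappa> ^ j * R) F"
    for x R j F
  proof -
    \<comment> \<open>Leaving the other scales empty isolates one term of the sum.\<close>
    have "(\<Sum>i=1..j. real (card (if i = j then F else {})) * (\<kappa> ^ i) powr s) \<le> Q"
      using that by (intro sum_bound[of x R]) (auto simp: separated_def)
    also have "(\<Sum>i=1..j. real (card (if i = j then F else {})) * (\<kappa> ^ i) powr s)
        = (\<Sum>i=1..j. if i = j then real (card F) * (\<kappa> ^ i) powr s else 0)"
      by (intro sum.cong) auto
    also have "\<dots> = real (card F) * (\<kappa> ^ j) powr s"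
      using that by simp
    finally show ?thesis .
  qed
  obtain x1 where x1: "x1 \<in> E" using assms by auto
  have "0 < Q"
  proof -
    have "0 < real (card {x1}) * (\<kappa> ^ 1) powr s" using assms by simp
    also have "\<dots> \<le> Q"
      using x1 assms by (intro single[of x1 "D / 2"]) (auto simp: separated_def)
    finally show ?thesis .
  qed
  define t where "t = \<kappa> ^ J"
  have t: "0 < t" "t < 1"
    using assms J by (auto simp: t_def power_less_one_iff)
  \<comment> \<open>The second entry is the largest \<open>\<eta>\<close> with \<open>t^\<eta> \<ge> 1/2\<close>.\<close>
  define \<eta> where "\<eta> = min s (ln 2 / - ln t)"
  have \<eta>: "0 < \<eta>" "\<eta> \<le> s" using t \<open>0 < s\<close> by (auto simp: \<eta>_def divide_pos_neg)
  have "1 / 2 \<le> t powr \<eta>"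
  proof -
    have "\<eta> \<le> ln 2 / - ln t" by (simp add: \<eta>_def)
    then have "- ln 2 \<le> \<eta> * ln t"
      using t ln_less_zero[of t] by (simp add: field_simps)
    then have "exp (- ln 2) \<le> exp (\<eta> * ln t)" by simp
    with t show ?thesis by (simp add: powr_def exp_minus)
  qed
  define l where "l = s - \<eta>"
  have l: "0 \<le> l" "l < s" using \<eta> by (auto simp: l_def)
  define C where "C = Q / t powr s"
  have "0 < C" using \<open>0 < Q\<close> t by (simp add: C_def)
  have net: "\<exists>j G. j \<in> {1..J} \<and> finite G \<and> G \<subseteq> E \<and> E \<inter> ball x R \<subseteq> (\<Union>z\<in>G. ball z (\<kappa> ^ j * R))
      \<and> real (card G) * (\<kappa> ^ j) powr l \<le> 1"
    if x: "x \<in> E" and R: "0 < R" "R < D" for x R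
  proof -
    have "\<exists>G. finite G \<and> G \<subseteq> E \<inter> ball x R \<and> separated (\<kappa> ^ j * R) G
        \<and> E \<inter> ball x R \<subseteq> (\<Union>z\<in>G. ball z (\<kappa> ^ j * R))" if "1 \<le> j" for j
    proof -
      have "real (card G) \<le> Q / (\<kappa> ^ j) powr s"
        if "finite G" "G \<subseteq> E \<inter> ball x R" "separated (\<kappa> ^ j * R) G" for G
        using single[OF x R \<open>1 \<le> j\<close> that] assms by (simp add: field_simps)
      moreover have "0 < \<kappa> ^ j * R" using assms R by simp
      ultimately show ?thesis
        using ex_separated_net[of "\<kappa> ^ j * R" "E \<inter> ball x R"] by metis
    qed
    then obtain G where G: "\<And>j. 1 \<le> j \<Longrightarrow> finite (G j) \<and> G j \<subseteq> E \<inter> ball x R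
        \<and> separated (\<kappa> ^ j * R) (G j) \<and> E \<inter> ball x R \<subseteq> (\<Union>z\<in>G j. ball z (\<kappa> ^ j * R))"
      by metis
    have "\<exists>j\<in>{1..J}. real (card (G j)) * (\<kappa> ^ j) powr s \<le> 1 / 2"
    proof (rule ccontr)
      assume "\<not> ?thesis"
      then have "(\<Sum>j=1..J. 1 / 2) \<le> (\<Sum>j=1..J. real (card (G j)) * (\<kappa> ^ j) powr s)"
        by (intro sum_mono) force
      also have "\<dots> \<le> Q"
        using G by (intro sum_bound[OF x R]) auto
      finally show False using J by simp
    qed
    then obtain j where j: "j \<in> {1..J}" "real (card (G j)) * (\<kappa> ^ j) powr s \<le> 1 / 2" by blast
    have "t \<le> \<kappa> ^ j"
      unfolding t_def using j assms by (intro power_decreasing) auto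
    then have "1 / 2 \<le> (\<kappa> ^ j) powr \<eta>"
      using \<open>1 / 2 \<le> t powr \<eta>\<close> t \<eta> by (meson less_imp_le order_trans powr_mono2)
    moreover have "(\<kappa> ^ j) powr s = (\<kappa> ^ j) powr l * (\<kappa> ^ j) powr \<eta>"
      by (simp add: powr_add[symmetric] l_def)
    ultimately have "(real (card (G j)) * (\<kappa> ^ j) powr l) * (\<kappa> ^ j) powr \<eta> \<le> 1 * (\<kappa> ^ j) powr \<eta>"
      using j(2) by (simp add: mult.assoc)
    then have "real (card (G j)) * (\<kappa> ^ j) powr l \<le> 1"
      using assms by (simp only: mult_le_cancel_right) auto
    with j(1) G[of j] show ?thesis by (intro exI[of _ j] exI[of _ "G j"]) auto
  qed
  have main: "real (card F) \<le> C * (R / r) powr l"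
    if "x \<in> E" "0 < r" "r < R" "R < D" "finite F" "F \<subseteq> E \<inter> ball x R" "separated r F"
      "\<kappa> ^ k * R \<le> r" for x R r F k
    using that
  \<comment> \<open>A cover with scale index \<open>j\<close> lowers \<open>k\<close> by \<open>j\<close>. Once \<open>t * R \<le> r\<close>, the bound for a single
    scale applies.\<close>
  proof (induction k arbitrary: x R F rule: less_induct)
    case (less k)
    have "0 < R" using less.prems by linarith
    show ?case
    proof (cases "t * R \<le> r")
      case True
      then have "real (card F) * t powr s \<le> Q"
        unfolding t_def using less.prems J \<open>0 < R\<close>
        by (intro single[of x R J F]) (auto intro: separated_mono)
      then have "real (card F) \<le> C" using t by (simp add: C_def field_simps)
      also have "C * 1 \<le> C * (R / r) powr l"
        using less.prems l \<open>0 < C\<close> by (intro mult_left_mono ge_one_powr_ge_zero) auto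
      finally show ?thesis by simp
    next
      case False
      from net[OF \<open>x \<in> E\<close> \<open>0 < R\<close> \<open>R < D\<close>] obtain j G where
        j: "1 \<le> j" "j \<le> J" and G: "finite G" "G \<subseteq> E" "E \<inter> ball x R \<subseteq> (\<Union>z\<in>G. ball z (\<kappa> ^ j * R))"
        "real (card G) * (\<kappa> ^ j) powr l \<le> 1" by auto
      let ?R = "\<kappa> ^ j * R"
      have "t \<le> \<kappa> ^ j" unfolding t_def using j assms by (intro power_decreasing) auto
      then have "t * R \<le> ?R" using \<open>0 < R\<close> by simp
      with False have rR: "r < ?R" by linarith
      have "\<kappa> ^ j \<le> 1" using assms by (intro power_le_one) auto
      then have "?R \<le> R" using \<open>0 < R\<close> by simp
      have "j < k"
      proof (rule ccontr)
        assume "\<not> j < k"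
        then have "\<kappa> ^ j \<le> \<kappa> ^ k" using assms by (intro power_decreasing) auto
        then have "?R \<le> \<kappa> ^ k * R" using \<open>0 < R\<close> by simp
        then show False using rR less.prems by linarith
      qed
      have IH: "real (card (F \<inter> ball z ?R)) \<le> C * (?R / r) powr l" if "z \<in> G" for z
      proof (rule less.IH[of "k - j" z ?R "F \<inter> ball z ?R"])
        have "\<kappa> ^ (k - j) * \<kappa> ^ j = \<kappa> ^ k"
          using \<open>j < k\<close> by (simp add: power_add[symmetric])
        then show "\<kappa> ^ (k - j) * ?R \<le> r" using less.prems by (simp add: mult.assoc[symmetric])
      qed (use that G less.prems rR \<open>j < k\<close> j \<open>?R \<le> R\<close> in \<open>auto intro: separated_mono\<close>)
      have "F = (\<Union>z\<in>G. F \<inter> ball z ?R)" using G less.prems by auto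
      then have "card F \<le> (\<Sum>z\<in>G. card (F \<inter> ball z ?R))"
        using card_UN_le[OF \<open>finite G\<close>, of "\<lambda>z. F \<inter> ball z ?R"] by simp
      then have "real (card F) \<le> (\<Sum>z\<in>G. real (card (F \<inter> ball z ?R)))"
        by (metis of_nat_le_iff of_nat_sum)
      also have "\<dots> \<le> (\<Sum>z\<in>G. C * (?R / r) powr l)"
        by (intro sum_mono IH)
      also have "\<dots> = (real (card G) * (\<kappa> ^ j) powr l) * (C * (R / r) powr l)"
        using assms less.prems \<open>0 < R\<close> by (simp add: powr_mult powr_divide)
      also have "\<dots> \<le> 1 * (C * (R / r) powr l)"
        using G(4) \<open>0 < C\<close> by (intro mult_right_mono) auto
      finally show ?thesis by simp
    qed
  qed
  show thesis
  proof (rule that[OF l \<open>0 < C\<close>])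
    fix x R r F
    assume h: "x \<in> E" "0 < r" "r < R" "R < D" "finite F" "F \<subseteq> E \<inter> ball x R" "separated r F"
    then obtain k where "\<kappa> ^ k < r / R"
      using real_arch_pow_inv[of "r / R" \<kappa>] \<open>\<kappa> < 1\<close> by auto
    with h have "\<kappa> ^ k * R \<le> r" by (simp add: field_simps)
    with h show "real (card F) \<le> C * (R / r) powr l" by (rule main)
  qed
qed

section \<open>The Assouad dimension\<close>

text \<open>Packing rather than covering numbers are bounded because subsets of separated sets are separated,
whereas the centres of a cover would have to be moved; a maximal separated set provides a cover with
centres in the set.\<close>

lemma Assouad_dim_le:
  fixes E :: "'a::euclidean_space set"
  assumes "bounded E" "0 \<le> l" "0 < C" "diameter E \<le> D"
    and pack: "\<And>x R r F. x \<in> E \<Longrightarrow> 0 < r \<Longrightarrow> r < R \<Longrightarrow> R < D \<Longrightarrow> finite F \<Longrightarrow>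
       F \<subseteq> E \<inter> ball x R \<Longrightarrow> separated r F \<Longrightarrow> real (card F) \<le> C * (R / r) powr l"
  shows "Assouad_dim E \<le> l"
  unfolding Assouad_dim_def
proof (rule cInf_lower)
  have "real (covering_number (E \<inter> ball x R) r) \<le> C * (r / R) powr - l"
    if x: "x \<in> E" and r: "0 < r" "r < R" and R: "R < diameter E" for x r R
  proof -
    have "R < D" using R assms by linarith
    note bd = pack[OF x r this]
    obtain F where F: "finite F" "F \<subseteq> E \<inter> ball x R" "separated r F"
      "E \<inter> ball x R \<subseteq> (\<Union>z\<in>F. ball z r)"
      using ex_separated_net[OF \<open>0 < r\<close> bd] by blast
    have "covering_number (E \<inter> ball x R) r \<le> card F"
      unfolding covering_number_def using F by (intro Least_le) blast
    then have "real (covering_number (E \<inter> ball x R) r) \<le> C * (R / r) powr l"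
      using bd[OF F(1-3)] by linarith
    also have "(R / r) powr l = (r / R) powr - l"
      using r by (simp add: powr_minus powr_divide)
    finally show ?thesis .
  qed
  with assms show "l \<in> {l. 0 \<le> l \<and>
       (\<exists>C>0. \<forall>x\<in>E. \<forall>r R. 0 < r \<and> r < R \<and> (bounded E \<longrightarrow> R < diameter E) \<longrightarrow>
          real (covering_number (E \<inter> ball x R) r) \<le> C * (r / R) powr (- l))}"
    by blast
  show "bdd_below {l. 0 \<le> l \<and>
       (\<exists>C>0. \<forall>x\<in>E. \<forall>r R. 0 < r \<and> r < R \<and> (bounded E \<longrightarrow> R < diameter E) \<longrightarrow>
          real (covering_number (E \<inter> ball x R) r) \<le> C * (r / R) powr (- l))}"
    by (rule bdd_belowI[of _ 0]) blast
qed

text \<open>For a one-point set the definition of porosity is vacuous, as the diameter is \<open>0\<close>. Such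
a set is porous at all scales, so a positive range of scales is available in every case.\<close>

lemma porous_at_positive_scales:
  fixes E :: "'a::euclidean_space set"
  assumes "porous E" "bounded E" "E \<noteq> {}"
  obtains c D where "0 < c" "c < 1" "0 < D" "diameter E \<le> D"
    "\<And>x r. x \<in> E \<Longrightarrow> 0 < r \<Longrightarrow> r < D \<Longrightarrow> \<exists>y. ball y (c * r) \<subseteq> ball x r - E"
proof (cases "diameter E = 0")
  case False
  then have "0 < diameter E"
    using diameter_ge_0[OF assms(2)] by linarith
  moreover obtain c where "0 < c" "c < 1"
    "\<forall>x\<in>E. \<forall>r. 0 < r \<and> (bounded E \<longrightarrow> r < diameter E) \<longrightarrow> (\<exists>y. ball y (c * r) \<subseteq> ball x r - E)"
    using \<open>porous E\<close> unfolding porous_def by blast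
  ultimately show thesis
    using that[of c "diameter E"] by blast
next
  case True
  obtain x0 where x0: "x0 \<in> E" using assms by auto
  have "x = x0" if "x \<in> E" for x
    using diameter_bounded_bound[OF assms(2) x0 that] True by simp
  with x0 have E: "E = {x0}" by blast
  have "\<exists>y. ball y (1 / 4 * r) \<subseteq> ball x0 r - E" if "0 < r" for r
  proof -
    obtain e :: 'a where e: "norm e = 1" using vector_choose_size[of 1] by auto
    define y where "y = x0 + (r / 2) *\<^sub>R e"
    have y: "dist x0 y = r / 2" using e that by (simp add: y_def dist_norm)
    have "w \<in> ball x0 r - E" if w: "dist y w < 1 / 4 * r" for w
      using w y \<open>0 < r\<close> dist_triangle[of x0 w y] by (auto simp: E dist_commute)
    then show ?thesis by (intro exI[of _ y]) (meson mem_ball subsetI)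
  qed
  then show thesis
    by (intro that[of "1 / 4" 1]) (auto simp: True E)
qed

theorem theorem6p2:
  fixes E :: "(real ^ 'n) set" and p q \<beta> n :: real
  defines "n \<equiv> real CARD('n)"
  assumes "CARD('n) \<ge> 2"
    and "E \<noteq> {}" and "compact E" and "porous E"
    and "\<beta> < 0"
    and "1 \<le> p" and "p < q" and "p < n" and "q < n * p / (n - p)"
    and "\<exists>C>0. \<forall>f \<in> (C0_infty :: (real ^ 'n \<Rightarrow> real) set).
        epowr (\<integral>\<^sup>+ x. ennreal (\<bar>f x\<bar> powr q)
                 * epowr (ennreal (infdist x E)) (q / p * (n - p + \<beta>) - n) \<partial>lborel) (1 / q)
        \<le> ennreal C *
          epowr (\<integral>\<^sup>+ x. ennreal (norm (gradient f x) powr p)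
                 * epowr (ennreal (infdist x E)) \<beta> \<partial>lborel) (1 / p)"
  shows "Assouad_dim E < q / p * (n - p + \<beta>)"
proof -
  define s where "s = q / p * (n - p + \<beta>)"
  define a where "a = n - s"
  define b where "b = - \<beta>"
  have pq: "0 < p" "0 < q" "0 < b" using assms by (auto simp: b_def)
  have n: "n = real DIM(real ^ 'n)" by (simp add: n_def)
  \<comment> \<open>The subcriticality \<open>q < n p / (n - p)\<close> amounts to \<open>b q < a p\<close>, the gain that
    the growth estimate needs.\<close>
  have "q * (n - p) < n * p"
    using assms by (simp add: field_simps)
  moreover have "a * p = n * p - q * (n - p) + b * q"
    using pq by (simp add: a_def s_def b_def field_simps)
  ultimately have gain: "b * q < a * p" by linarith
  moreover have "b * p < b * q" using assms pq by simp
  ultimately have "b * p < a * p" by linarith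
  then have "b < a" using pq by simp
  have "bounded E" using assms compact_imp_bounded by blast
  obtain C where C: "0 < C" "\<And>f. f \<in> (C0_infty :: (real ^ 'n \<Rightarrow> real) set) \<Longrightarrow>
        epowr (\<integral>\<^sup>+ x. ennreal (\<bar>f x\<bar> powr q) * dist_weight E (- a) x \<partial>lborel) (1 / q)
        \<le> ennreal C *
          epowr (\<integral>\<^sup>+ x. ennreal (norm (gradient f x) powr p) * dist_weight E (- b) x \<partial>lborel) (1 / p)"
    using assms(11) by (auto simp: dist_weight_def a_def b_def s_def)
  obtain K where K: "0 < K"
    "\<And>x R t. 0 < R \<Longrightarrow> 0 \<le> t \<Longrightarrow>
        emeasure (dist_measure E (- b)) (ball x (2 * R) - ball x R) \<le> ennreal t \<Longrightarrow>
        emeasure (dist_measure E (- a)) (ball x R) \<le> ennreal ((K / R * t powr (1 / p)) powr q)"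
    using Hardy_Sobolev_on_balls[OF pq(1,2) _ _ C] pq \<open>b < a\<close> by auto
  obtain c D where c: "0 < c" "c < 1" and D: "0 < D" "diameter E \<le> D"
    and porous: "\<And>x r. x \<in> E \<Longrightarrow> 0 < r \<Longrightarrow> r < D \<Longrightarrow> \<exists>y. ball y (c * r) \<subseteq> ball x r - E"
    using porous_at_positive_scales[OF \<open>porous E\<close> \<open>bounded E\<close> \<open>E \<noteq> {}\<close>] by metis
  have "q / p * (n - p - b) = n - a" by (simp add: a_def s_def b_def)
  then obtain M where M: "0 < M"
    "\<And>x R. x \<in> E \<Longrightarrow> 0 < R \<Longrightarrow> R < 2 * D \<Longrightarrow>
       emeasure (dist_measure E (- a)) (ball x R) \<le> ennreal (M * R powr (n - a))"
    using dist_measure_growth[OF \<open>bounded E\<close> \<open>E \<noteq> {}\<close> pq(3) \<open>b < a\<close> pq(1,2) K(1) D(1) _ gain K(2)]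
    unfolding n by metis
  define Q where "Q = M * 2 powr (n - a) / (unit_ball_vol n * (c / 4) powr n)"
  have "0 < a" using pq \<open>b < a\<close> by linarith
  have packing: "(\<Sum>j=1..J. real (card (F j)) * ((c / 4) ^ j) powr (n - a)) \<le> Q"
    if "x \<in> E" "0 < R" "R < D" "\<And>j. j \<in> {1..J} \<Longrightarrow>
      finite (F j) \<and> F j \<subseteq> E \<inter> ball x R \<and> separated ((c / 4) ^ j * R) (F j)"
    for x R J F
    unfolding Q_def n
    by (rule dist_measure_packing[OF \<open>0 < a\<close> c porous M(2)[unfolded n] that(1-3) M(1) that(4)])
  have "0 < c / 4" "c / 4 < 1" using c by auto
  from \<open>E \<noteq> {}\<close> D(1) this packing show ?thesis
  proof (rule packing_exponent_gap)
    fix l C'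
    assume "0 \<le> l" "l < n - a" "0 < C'"
      and "\<And>x R r F. x \<in> E \<Longrightarrow> 0 < r \<Longrightarrow> r < R \<Longrightarrow> R < D \<Longrightarrow> finite F \<Longrightarrow>
       F \<subseteq> E \<inter> ball x R \<Longrightarrow> separated r F \<Longrightarrow> real (card F) \<le> C' * (R / r) powr l"
    with \<open>bounded E\<close> D have "Assouad_dim E \<le> l" by (intro Assouad_dim_le)
    also have "l < s" using \<open>l < n - a\<close> by (simp add: a_def)
    finally show ?thesis by (simp add: s_def)
  qed
qed

end
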